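(* Let $K$ be a finite commutative unital ring. Then $K$ is local if and only if for all $a,b\in K$ with $\{[a],[b]\}\cap\{[0],[1]\}=\emptyset$ we have $$N([a])\cup N([b])\subsetneq N([ab])$$ within the graph $\varTheta(K)$.
   Context: On a finite commutative unital ring $K$, elements $a,b$ are associated, $a\sim b$, if $a=bu$ for some invertible $u\in K$; $[a]$ is the class of $a$. The graph $\varTheta(K)$ has as vertices all associatedness classes of elements of $K$ (including $[0]$ and $[1]$), and vertices $[u]$, $[v]$ (not necessarily distinct) are adjacent if and only if $uv=0$; so loops are allowed. For a vertex $v$, $N(v)$ is the set of all vertices adjacent to $v$ (including $v$ itself if there is a loop at $v$). The elements $a$ and $b$ in the claim are not required to be distinct. Convention: the zero ring is a unital ring and is counted as local, i.e. "local" means having at most one maximal ideal (equivalently, for finite commutative unital rings, not being a direct product of two nonzero rings). *)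

theory Defs
  imports "HOL-Algebra.Ideal"
begin

(* "At most one" rather than "exactly one" maximal ideal: the zero ring counts as local. *)
definition local_cring :: "('a, 'm) ring_scheme \<Rightarrow> bool" where
  "local_cring K \<longleftrightarrow>
     cring K \<and> (\<forall>I J. maximalideal I K \<and> maximalideal J K \<longrightarrow> I = J)"

(* Not the library's associated (mutual divisibility), which over a general commutative
   ring is a weaker relation than differing by a unit factor. *)
definition assoc_rel :: "('a, 'm) ring_scheme \<Rightarrow> ('a \<times> 'a) set" where
  "assoc_rel K =
     {(a, b). a \<in> carrier K \<and> b \<in> carrier K \<and> (\<exists>u \<in> Units K. a = b \<otimes>\<^bsub>K\<^esub> u)}"

definition assoc_class :: "('a, 'm) ring_scheme \<Rightarrow> 'a \<Rightarrow> 'a set" where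
  "assoc_class K a = assoc_rel K `` {a}"

definition theta_verts :: "('a, 'm) ring_scheme \<Rightarrow> 'a set set" where
  "theta_verts K = carrier K // assoc_rel K"

definition theta_adj :: "('a, 'm) ring_scheme \<Rightarrow> 'a set \<Rightarrow> 'a set \<Rightarrow> bool" where
  "theta_adj K X Y \<longleftrightarrow>
     (\<exists>u \<in> carrier K. \<exists>v \<in> carrier K.
        X = assoc_class K u \<and> Y = assoc_class K v \<and> u \<otimes>\<^bsub>K\<^esub> v = \<zero>\<^bsub>K\<^esub>)"

definition theta_nbhd :: "('a, 'm) ring_scheme \<Rightarrow> 'a set \<Rightarrow> 'a set set" where
  "theta_nbhd K X = {Y \<in> theta_verts K. theta_adj K X Y}"

lemma (in cring) equiv_assoc_rel: "equiv (carrier R) (assoc_rel R)"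
proof (rule equivI)
  show "assoc_rel R \<subseteq> carrier R \<times> carrier R"
    by (auto simp: assoc_rel_def)
  show "refl_on (carrier R) (assoc_rel R)"
    by (auto simp: refl_on_def assoc_rel_def intro!: bexI[of _ \<one>])
  show "sym (assoc_rel R)"
  proof (rule symI)
    fix a b assume "(a, b) \<in> assoc_rel R"
    then obtain u where u: "u \<in> Units R" "a = b \<otimes> u" "a \<in> carrier R" "b \<in> carrier R"
      by (auto simp: assoc_rel_def)
    then have "b = a \<otimes> inv u"
      by (simp add: m_assoc Units_closed)
    with u show "(b, a) \<in> assoc_rel R"
      by (auto simp: assoc_rel_def)
  qed
  show "trans (assoc_rel R)"
  proof (rule transI)
    fix a b c assume "(a, b) \<in> assoc_rel R" "(b, c) \<in> assoc_rel R"
    then obtain u v where "u \<in> Units R" "a = b \<otimes> u" "v \<in> Units R" "b = c \<otimes> v"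
      "a \<in> carrier R" "b \<in> carrier R" "c \<in> carrier R"
      by (auto simp: assoc_rel_def)
    then show "(a, c) \<in> assoc_rel R"
      by (auto simp: assoc_rel_def m_assoc Units_closed intro!: bexI[of _ "v \<otimes> u"])
  qed
qed

(* Adjacency does not depend on the chosen representatives. *)
lemma (in cring) theta_adj_assoc_class_iff:
  assumes "a \<in> carrier R" "b \<in> carrier R"
  shows "theta_adj R (assoc_class R a) (assoc_class R b) \<longleftrightarrow> a \<otimes> b = \<zero>"
proof
  assume "a \<otimes> b = \<zero>"
  with assms show "theta_adj R (assoc_class R a) (assoc_class R b)"
    by (auto simp: theta_adj_def)
next
  assume "theta_adj R (assoc_class R a) (assoc_class R b)"
  then obtain u v where uv: "u \<in> carrier R" "v \<in> carrier R" "u \<otimes> v = \<zero>"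
    and "assoc_class R a = assoc_class R u" "assoc_class R b = assoc_class R v"
    by (auto simp: theta_adj_def)
  then have "(a, u) \<in> assoc_rel R" "(b, v) \<in> assoc_rel R"
    using assms eq_equiv_class[OF _ equiv_assoc_rel] by (auto simp: assoc_class_def)
  then obtain p q where pq: "p \<in> carrier R" "q \<in> carrier R" "a = u \<otimes> p" "b = v \<otimes> q"
    by (auto simp: assoc_rel_def Units_closed)
  then have "a \<otimes> b = (u \<otimes> v) \<otimes> (p \<otimes> q)"
    using uv(1,2) by (simp add: m_ac)
  with uv pq show "a \<otimes> b = \<zero>"
    by simp
qed

end

(* Everything rests on the fact that some power n > 0 of an element x of a finite monoid is
   idempotent. If K has maximal ideals I \<noteq> J, then for x in I - J this power e is an idempotent
   that is neither 0 nor a unit, and a = b = e violates the strict inclusion because ee = e.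
   If K is local, then e and 1 - e cannot both be nonunits, so nonunits are nilpotent; for nonzero
   nonunits a and b this gives x with xab = 0, xa \<noteq> 0 and y with yab = 0, yb \<noteq> 0, and one of
   x, y, x + y annihilates ab but neither a nor b. *)
theory Submission
  imports Defs
begin

section \<open>Idempotent powers, maximal ideals and nilpotency under finiteness\<close>

text \<open>By pigeonhole two powers coincide, so exponents from some \<open>i\<close> on are
  periodic with a period \<open>p\<close>. The exponent \<open>i * p\<close> lies in the periodic
  range and is a multiple of \<open>p\<close>, hence doubling it leaves the power unchanged.\<close>

lemma (in monoid) finite_imp_idempotent_pow:
  assumes "finite (carrier G)" "x \<in> carrier G"
  obtains n :: nat where "n > 0" "x [^] n \<otimes> x [^] n = x [^] n"
proof -
  have "\<not> inj_on (\<lambda>n::nat. x [^] n) {0<..}"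
  proof
    assume "inj_on (\<lambda>n::nat. x [^] n) {0<..}"
    moreover have "(\<lambda>n::nat. x [^] n) ` {0<..} \<subseteq> carrier G"
      using assms(2) by auto
    ultimately have "finite {0::nat<..}"
      using assms(1) finite_imageD finite_subset by metis
    then show False
      by (simp add: infinite_Ioi)
  qed
  then obtain i j :: nat where "0 < i" "0 < j" "i \<noteq> j" "x [^] i = x [^] j"
    by (auto simp: inj_on_def)
  then obtain i p :: nat where ip: "0 < i" "0 < p" "x [^] i = x [^] (i + p)"
    by (metis add_diff_inverse_nat less_imp_le linorder_neqE_nat not_less zero_less_diff)
  have period: "x [^] (i + k * p + m) = x [^] (i + m)" for k m :: nat
  proof (induction k)
    case (Suc k)
    have "x [^] (i + Suc k * p + m) = x [^] (i + p) \<otimes> x [^] (k * p + m)"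
      using assms(2) by (simp add: nat_pow_mult ac_simps)
    also have "\<dots> = x [^] (i + k * p + m)"
      using assms(2) by (simp flip: ip(3) add: nat_pow_mult ac_simps)
    finally show ?case
      using Suc by simp
  qed simp
  \<comment> \<open>Positivity of \<open>p\<close> gives \<open>i * p\<close> \<ge>
    \<open>i\<close>, which places this exponent in the periodic range.\<close>
  obtain m where m: "i * p = i + m"
    using ip(2) by (cases p) auto
  have "x [^] (i * p) \<otimes> x [^] (i * p) = x [^] (i + i * p + m)"
    using assms(2) by (simp add: nat_pow_mult m add_ac)
  also have "\<dots> = x [^] (i * p)"
    using period[of i m] by (simp add: m)
  finally show ?thesis
    using ip that[of "i * p"] by simp
qed

text \<open>The principal ideal of a nonunit is proper, and finiteness replaces Zorn's lemma: among
  the finitely many proper ideals containing \<open>x\<close>, one is maximal under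
  inclusion.\<close>

lemma (in cring) finite_nonunit_in_maximalideal:
  assumes "finite (carrier R)" "x \<in> carrier R" "x \<notin> Units R"
  obtains M where "maximalideal M R" "x \<in> M"
proof -
  define S where "S = {I. ideal I R \<and> x \<in> I \<and> I \<noteq> carrier R}"
  have sub: "S \<subseteq> Pow (carrier R)"
    by (auto simp: S_def dest: additive_subgroup.a_Hcarr ideal.axioms(1))
  have "\<one> \<notin> PIdl x"
    using assms(2,3) m_comm by (force simp: cgenideal_def Units_def)
  then have "PIdl x \<in> S"
    using assms(2) by (auto simp: S_def cgenideal_ideal cgenideal_self)
  moreover have "finite S"
    using sub assms(1) finite_subset by blast
  ultimately obtain M where M: "M \<in> S" "\<forall>I \<in> S. M \<subseteq> I \<longrightarrow> M = I"
    using finite_has_maximal[of S] by auto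
  have "maximalideal M R"
    by (rule maximalidealI) (use M in \<open>auto simp: S_def\<close>)
  then show ?thesis
    using M(1) that by (auto simp: S_def)
qed

lemma (in cring) finite_local_nonunit_nilpotent:
  assumes "finite (carrier R)" "local_cring R" "x \<in> carrier R" "x \<notin> Units R"
  obtains n :: nat where "x [^] n = \<zero>"
proof -
  obtain n :: nat where n: "n > 0" "x [^] n \<otimes> x [^] n = x [^] n"
    using finite_imp_idempotent_pow assms(1,3) by blast
  define e where "e = x [^] n"
  have e: "e \<in> carrier R" "e \<otimes> e = e"
    using n assms(3) by (auto simp: e_def)
  obtain M where M: "maximalideal M R" "x \<in> M"
    using finite_nonunit_in_maximalideal assms by blast
  interpret M: maximalideal M R
    by fact
  \<comment> \<open>Positivity of \<open>n\<close> matters: \<open>x [^] 0\<close> is one, which no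
    proper ideal contains.\<close>
  have "e \<in> M"
    using n(1) M(2) assms(3) M.I_l_closed by (cases n) (auto simp: e_def)
  have "\<one> \<ominus> e \<in> Units R"
  proof (rule ccontr)
    assume "\<one> \<ominus> e \<notin> Units R"
    then obtain N where "maximalideal N R" "\<one> \<ominus> e \<in> N"
      using finite_nonunit_in_maximalideal[OF assms(1)] e(1) by blast
    then have "\<one> \<ominus> e \<in> M"
      using assms(2) M(1) by (auto simp: local_cring_def)
    then have "(\<one> \<ominus> e) \<oplus> e \<in> M"
      using \<open>e \<in> M\<close> M.a_closed by blast
    moreover have "(\<one> \<ominus> e) \<oplus> e = \<one>"
      using e(1) by algebra
    ultimately show False
      using M.one_imp_carrier M.I_notcarr by auto
  qed
  \<comment> \<open>Zero is written as a multiple of \<open>\<one> \<ominus> e\<close> so that this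
    unit can be cancelled.\<close>
  moreover have "(\<one> \<ominus> e) \<otimes> e = (\<one> \<ominus> e) \<otimes> \<zero>"
    using e by algebra
  ultimately have "e = \<zero>"
    using e(1) Units_l_cancel by blast
  then show ?thesis
    using that by (simp add: e_def)
qed

section \<open>Annihilators of products of nilpotent elements\<close>

text \<open>Multiply \<open>a\<close> by successive powers of \<open>b\<close> until the product
  vanishes; the last power before that is the witness.\<close>

lemma (in cring) nilpotent_annihilator_witness:
  assumes "a \<in> carrier R" "b \<in> carrier R" "a \<noteq> \<zero>" "b [^] (n::nat) = \<zero>"
  obtains x where "x \<in> carrier R" "a \<otimes> x \<noteq> \<zero>" "a \<otimes> b \<otimes> x = \<zero>"
proof -
  define m where "m = (LEAST m::nat. a \<otimes> b [^] m = \<zero>)"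
  have "a \<otimes> b [^] n = \<zero>"
    using assms by simp
  then have m: "a \<otimes> b [^] m = \<zero>"
    unfolding m_def by (rule LeastI)
  \<comment> \<open>The exponent zero is excluded because \<open>a\<close> itself is
    nonzero.\<close>
  with assms obtain k where k: "m = Suc k"
    by (cases m) auto
  have "a \<otimes> b [^] k \<noteq> \<zero>"
    using not_less_Least[of k "\<lambda>m. a \<otimes> b [^] m = \<zero>"] k by (simp add: m_def)
  moreover have "a \<otimes> b \<otimes> b [^] k = \<zero>"
    using m assms by (simp add: k m_ac)
  ultimately show ?thesis
    using that assms by blast
qed

lemma (in cring) nilpotent_common_annihilator_witness:
  assumes "a \<in> carrier R" "b \<in> carrier R" "a \<noteq> \<zero>" "b \<noteq> \<zero>"
    and "a [^] (m::nat) = \<zero>" "b [^] (n::nat) = \<zero>"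
  obtains z where "z \<in> carrier R" "a \<otimes> z \<noteq> \<zero>" "b \<otimes> z \<noteq> \<zero>" "a \<otimes> b \<otimes> z = \<zero>"
proof -
  obtain x where x: "x \<in> carrier R" "a \<otimes> x \<noteq> \<zero>" "a \<otimes> b \<otimes> x = \<zero>"
    using nilpotent_annihilator_witness assms by blast
  obtain y where y: "y \<in> carrier R" "b \<otimes> y \<noteq> \<zero>" "a \<otimes> b \<otimes> y = \<zero>"
    using nilpotent_annihilator_witness[of b a m] assms m_comm by metis
  consider "b \<otimes> x \<noteq> \<zero>" | "a \<otimes> y \<noteq> \<zero>" | "b \<otimes> x = \<zero>" "a \<otimes> y = \<zero>"
    by blast
  then show ?thesis
  proof cases
    \<comment> \<open>Here the cross terms vanish, so \<open>a\<close> sends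
      \<open>x \<oplus> y\<close> to \<open>a \<otimes> x\<close> and \<open>b\<close> sends it to
      \<open>b \<otimes> y\<close>, both nonzero.\<close>
    case 3
    then show ?thesis
      using that[of "x \<oplus> y"] x y assms by (simp add: r_distr)
  qed (use that x y in blast)+
qed

section \<open>From the graph to annihilators\<close>

lemma (in cring) assoc_class_eq_iff:
  assumes "a \<in> carrier R" "b \<in> carrier R"
  shows "assoc_class R a = assoc_class R b \<longleftrightarrow> (\<exists>u \<in> Units R. a = b \<otimes> u)"
  using eq_equiv_class_iff[OF equiv_assoc_rel assms] assms
  by (simp add: assoc_class_def assoc_rel_def)

text \<open>The class of zero is a singleton and the class of one is the group of units.\<close>

lemma (in cring) assoc_classes_disjoint_zero_one_iff:
  assumes "a \<in> carrier R" "b \<in> carrier R"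
  shows "{assoc_class R a, assoc_class R b} \<inter> {assoc_class R \<zero>, assoc_class R \<one>} = {} \<longleftrightarrow>
    a \<noteq> \<zero> \<and> b \<noteq> \<zero> \<and> a \<notin> Units R \<and> b \<notin> Units R"
proof -
  have "assoc_class R x \<in> {assoc_class R \<zero>, assoc_class R \<one>} \<longleftrightarrow> x = \<zero> \<or> x \<in> Units R"
    if "x \<in> carrier R" for x
    using that by (auto simp: assoc_class_eq_iff Units_closed)
  from this[OF assms(1)] this[OF assms(2)] show ?thesis
    unfolding Int_insert_left by auto
qed

lemma (in cring) theta_nbhd_assoc_class:
  assumes "a \<in> carrier R"
  shows "theta_nbhd R (assoc_class R a) = assoc_class R ` {x \<in> carrier R. a \<otimes> x = \<zero>}"
  using assms
  by (auto simp: theta_nbhd_def theta_verts_def quotient_def theta_adj_assoc_class_iff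
      simp flip: assoc_class_def)

text \<open>Used to refute membership: since adjacency is independent of representatives, testing
  \<open>x\<close> alone decides for its whole class.\<close>

lemma (in cring) assoc_class_in_theta_nbhd_iff:
  assumes "a \<in> carrier R" "x \<in> carrier R"
  shows "assoc_class R x \<in> theta_nbhd R (assoc_class R a) \<longleftrightarrow> a \<otimes> x = \<zero>"
  using assms
  by (auto simp: theta_nbhd_def theta_verts_def quotient_def theta_adj_assoc_class_iff
      simp flip: assoc_class_def)

text \<open>Whatever annihilates a factor annihilates the product. Hence only strictness of the
  inclusion is at stake in the theorem.\<close>

lemma (in cring) theta_nbhd_Un_subset_mult:
  assumes "a \<in> carrier R" "b \<in> carrier R"
  shows "theta_nbhd R (assoc_class R a) \<union> theta_nbhd R (assoc_class R b)
    \<subseteq> theta_nbhd R (assoc_class R (a \<otimes> b))"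
proof -
  have "a \<otimes> b \<otimes> x = \<zero>" if "x \<in> carrier R" "a \<otimes> x = \<zero> \<or> b \<otimes> x = \<zero>" for x
  proof -
    have "a \<otimes> b \<otimes> x = b \<otimes> (a \<otimes> x)" "a \<otimes> b \<otimes> x = a \<otimes> (b \<otimes> x)"
      using assms that(1) by (simp_all add: m_ac)
    then show ?thesis
      using assms that(2) by auto
  qed
  then show ?thesis
    using assms by (auto simp: theta_nbhd_assoc_class)
qed

section \<open>Strict inclusion for local rings, idempotents for nonlocal ones\<close>

lemma (in cring) finite_local_theta_nbhd_psubset:
  assumes "finite (carrier R)" "local_cring R" "a \<in> carrier R" "b \<in> carrier R"
    and "a \<noteq> \<zero>" "b \<noteq> \<zero>" "a \<notin> Units R" "b \<notin> Units R"
  shows "theta_nbhd R (assoc_class R a) \<union> theta_nbhd R (assoc_class R b)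
    \<subset> theta_nbhd R (assoc_class R (a \<otimes> b))"
proof -
  obtain m n :: nat where "a [^] m = \<zero>" "b [^] n = \<zero>"
    using finite_local_nonunit_nilpotent assms by metis
  then obtain z where "z \<in> carrier R" "a \<otimes> z \<noteq> \<zero>" "b \<otimes> z \<noteq> \<zero>" "a \<otimes> b \<otimes> z = \<zero>"
    using nilpotent_common_annihilator_witness assms by blast
  then have "assoc_class R z \<in> theta_nbhd R (assoc_class R (a \<otimes> b))"
    "assoc_class R z \<notin> theta_nbhd R (assoc_class R a) \<union> theta_nbhd R (assoc_class R b)"
    using assms by (auto simp: assoc_class_in_theta_nbhd_iff)
  then show ?thesis
    using theta_nbhd_Un_subset_mult assms(3,4) by blast
qed

lemma (in cring) finite_not_local_idempotent:
  assumes "finite (carrier R)" "\<not> local_cring R"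
  obtains e where "e \<in> carrier R" "e \<otimes> e = e" "e \<noteq> \<zero>" "e \<notin> Units R"
proof -
  obtain I J where IJ: "maximalideal I R" "maximalideal J R" "I \<noteq> J"
    using assms(2) is_cring by (auto simp: local_cring_def)
  interpret I: maximalideal I R
    by fact
  interpret J: primeideal J R
    using IJ(2) by (rule maximalideal_prime)
  \<comment> \<open>By maximality of \<open>I\<close>, inclusion in the proper ideal
    \<open>J\<close> would force equality.\<close>
  have "\<not> I \<subseteq> J"
    using I.I_maximal[OF J.is_ideal _ J.a_subset] IJ(3) J.I_notcarr by auto
  then obtain x where x: "x \<in> I" "x \<notin> J"
    by blast
  have xc: "x \<in> carrier R"
    using x(1) I.a_Hcarr by blast
  obtain n :: nat where n: "n > 0" "x [^] n \<otimes> x [^] n = x [^] n"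
    using finite_imp_idempotent_pow assms(1) xc by blast
  have "x [^] n \<in> I"
    using n(1) x(1) xc I.I_l_closed by (cases n) auto
  \<comment> \<open>A unit in \<open>I\<close> would put one into \<open>I\<close> and make it the
    whole ring.\<close>
  then have "x [^] n \<notin> Units R"
    using I.I_l_closed[of "x [^] n" "inv (x [^] n)"] I.one_imp_carrier I.I_notcarr by auto
  \<comment> \<open>Maximal ideals are prime, so no power of \<open>x\<close> enters
    \<open>J\<close>; as \<open>J\<close> contains zero, the idempotent power is nonzero.\<close>
  moreover have "x [^] k \<notin> J" for k :: nat
  proof (induction k)
    case 0
    then show ?case
      using J.one_imp_carrier J.I_notcarr by auto
  next
    case (Suc k)
    then show ?case
      using J.I_prime[of "x [^] k" x] xc x(2) by auto
  qed
  then have "x [^] n \<noteq> \<zero>"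
    using J.additive_subgroup_axioms additive_subgroup.zero_closed by metis
  ultimately show ?thesis
    using that n(2) xc by blast
qed

theorem theorem5p3:
  fixes K :: "('a, 'm) ring_scheme"
  assumes "cring K" and "finite (carrier K)"
  shows "local_cring K \<longleftrightarrow>
    (\<forall>a \<in> carrier K. \<forall>b \<in> carrier K.
      {assoc_class K a, assoc_class K b} \<inter> {assoc_class K \<zero>\<^bsub>K\<^esub>, assoc_class K \<one>\<^bsub>K\<^esub>} = {} \<longrightarrow>
      theta_nbhd K (assoc_class K a) \<union> theta_nbhd K (assoc_class K b)
        \<subset> theta_nbhd K (assoc_class K (a \<otimes>\<^bsub>K\<^esub> b)))"
    (is "_ \<longleftrightarrow> ?strict")
proof -
  interpret cring K
    by fact
  show ?thesis
  proof
    assume "local_cring K"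
    show ?strict
    proof (intro ballI impI)
      fix a b
      assume ab: "a \<in> carrier K" "b \<in> carrier K"
        and "{assoc_class K a, assoc_class K b} \<inter>
          {assoc_class K \<zero>\<^bsub>K\<^esub>, assoc_class K \<one>\<^bsub>K\<^esub>} = {}"
      then show "theta_nbhd K (assoc_class K a) \<union> theta_nbhd K (assoc_class K b)
          \<subset> theta_nbhd K (assoc_class K (a \<otimes>\<^bsub>K\<^esub> b))"
        using finite_local_theta_nbhd_psubset[OF assms(2) \<open>local_cring K\<close> ab]
        unfolding assoc_classes_disjoint_zero_one_iff[OF ab] by blast
    qed
  next
    assume strict: ?strict
    show "local_cring K"
    proof (rule ccontr)
      assume "\<not> local_cring K"
      then obtain e where "e \<in> carrier K" "e \<otimes>\<^bsub>K\<^esub> e = e" "e \<noteq> \<zero>\<^bsub>K\<^esub>" "e \<notin> Units K"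
        using finite_not_local_idempotent assms(2) by blast
      then show False
        using strict assoc_classes_disjoint_zero_one_iff[of e e] by fastforce
    qed
  qed
qed

end
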